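(* Let $\mathcal{A}$ be a bounded distributive lattice. If $\to$ is a weakly Boolean implication over $\mathcal{A}$, then the interval $[\neg 1, 1] = \{x \in \mathcal{A} \mid \neg 1 \leq x \leq 1\}$ with the induced order is a Boolean algebra, $a \to b = \neg a \vee b$ for all $a,b \in \mathcal{A}$, and $\neg a$ is the complement of $a \vee \neg 1$ in $[\neg 1, 1]$ for every $a \in \mathcal{A}$. Conversely, if for some $m \in \mathcal{A}$ the interval $[m, 1]$ with the induced order is a Boolean algebra, and $n(a)$ denotes the complement of $a \vee m$ in $[m,1]$, then $a \to_m b = n(a) \vee b$ is a weakly Boolean implication over $\mathcal{A}$, with $\neg_m a = n(a)$ and $\neg_m 1 = n(1) = m$ (where $\neg_m a = a \to_m 0$).
   Context: For a bounded distributive lattice $\mathcal{A}$, an implication over $\mathcal{A}$ is a binary operation $\to$ on $\mathcal{A}$ which is order-reversing in its first argument and order-preserving in its second argument and satisfies $a \to a = 1$ and $(a \to b) \wedge (b \to c) \leq a \to c$ for all $a,b,c$. For an implication, $\neg a$ abbreviates $a \to 0$. An implication is open if for all $a,b,c$, $a \wedge b \leq c$ implies $a \leq b \to c$; closed if for all $a,b,c$, $a \leq b \vee c$ implies $(a \to b) \vee c = 1$; weakly Boolean if it is both open and closed. *)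

theory Defs
  imports Main "HOL-Algebra.Lattice"
begin

(* HOL-Algebra's top would otherwise shadow the class operation on the ambient lattice. *)
hide_const (open) Order.top

section \<open>Implications\<close>

definition implication ::
    "('a::{distrib_lattice,bounded_lattice} \<Rightarrow> 'a \<Rightarrow> 'a) \<Rightarrow> bool" where
  "implication imp \<longleftrightarrow>
     (\<forall>c. antimono (\<lambda>a. imp a c)) \<and>
     (\<forall>c. mono (\<lambda>a. imp c a)) \<and>
     (\<forall>a. imp a a = top) \<and>
     (\<forall>a b c. inf (imp a b) (imp b c) \<le> imp a c)"

definition neg ::
    "('a::{distrib_lattice,bounded_lattice} \<Rightarrow> 'a \<Rightarrow> 'a) \<Rightarrow> 'a \<Rightarrow> 'a" where
  "neg imp a = imp a bot"

definition open_implication ::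
    "('a::{distrib_lattice,bounded_lattice} \<Rightarrow> 'a \<Rightarrow> 'a) \<Rightarrow> bool" where
  "open_implication imp \<longleftrightarrow>
     implication imp \<and> (\<forall>a b c. inf a b \<le> c \<longrightarrow> a \<le> imp b c)"

definition closed_implication ::
    "('a::{distrib_lattice,bounded_lattice} \<Rightarrow> 'a \<Rightarrow> 'a) \<Rightarrow> bool" where
  "closed_implication imp \<longleftrightarrow>
     implication imp \<and> (\<forall>a b c. a \<le> sup b c \<longrightarrow> sup (imp a b) c = top)"

definition weakly_boolean_implication ::
    "('a::{distrib_lattice,bounded_lattice} \<Rightarrow> 'a \<Rightarrow> 'a) \<Rightarrow> bool" where
  "weakly_boolean_implication imp \<longleftrightarrow>
     open_implication imp \<and> closed_implication imp"

section \<open>Boolean algebras as ordered sets\<close>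

text \<open>In the next two declarations the operations are the order-theoretic ones of the
  ordered set \<open>L\<close> itself, not those of an ambient lattice. One-element Boolean
  algebras are allowed.\<close>

definition is_complement :: "('a, 'b) gorder_scheme \<Rightarrow> 'a \<Rightarrow> 'a \<Rightarrow> bool" where
  "is_complement L x y \<longleftrightarrow>
     x \<in> carrier L \<and> y \<in> carrier L \<and>
     x \<sqinter>\<^bsub>L\<^esub> y = \<bottom>\<^bsub>L\<^esub> \<and> x \<squnion>\<^bsub>L\<^esub> y = \<top>\<^bsub>L\<^esub>"

locale boolean_lattice = Lattice.bounded_lattice +
  assumes meet_join_distrib:
      "\<lbrakk>x \<in> carrier L; y \<in> carrier L; z \<in> carrier L\<rbrakk>
        \<Longrightarrow> x \<sqinter> (y \<squnion> z) = (x \<sqinter> y) \<squnion> (x \<sqinter> z)"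
    and complement_exists: "x \<in> carrier L \<Longrightarrow> \<exists>y. is_complement L x y"

definition the_complement :: "('a, 'b) gorder_scheme \<Rightarrow> 'a \<Rightarrow> 'a" where
  "the_complement L x = (THE y. is_complement L x y)"

definition induced_order :: "'a::order set \<Rightarrow> 'a gorder" where
  "induced_order S = \<lparr>carrier = S, eq = (=), le = (\<le>)\<rparr>"

section \<open>The implication determined by an upper interval\<close>

text \<open>The element \<open>n(a)\<close>; meaningful when the interval \<open>[m, 1]\<close> is a Boolean algebra.\<close>

definition interval_neg :: "'a::{distrib_lattice,bounded_lattice} \<Rightarrow> 'a \<Rightarrow> 'a" where
  "interval_neg m a = the_complement (induced_order {m..top}) (sup a m)"

definition interval_imp :: "'a::{distrib_lattice,bounded_lattice} \<Rightarrow> 'a \<Rightarrow> 'a \<Rightarrow> 'a" where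
  "interval_imp m a b = sup (interval_neg m a) b"

end

(*
  Closedness applied to b <= 0 \/ b yields not b \/ b = 1 for every b; meeting with a -> b and
  using transitivity gives a -> b = not a \/ b. Openness gives a <= 1 -> a, so transitivity
  yields a /\ not a <= not 1. Hence not a is the complement of a \/ not 1 in [not 1, 1].
  In the converse direction every axiom follows from the two equations a \/ n(a) = 1 and
  (a \/ m) /\ n(a) = m by distributivity.
*)

theory Submission
  imports Defs
begin

section \<open>Upper intervals as ordered sets\<close>

lemma carrier_induced_order [simp]: "carrier (induced_order S) = S"
  and le_induced_order [simp]: "gorder.le (induced_order S) = (\<le>)"
  and eq_induced_order [simp]: "eq (induced_order S) = (=)"
  by (simp_all add: induced_order_def)

lemma partial_order_induced_order: "partial_order (induced_order S)"
  by unfold_locales auto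

text \<open>An upper interval is closed under the ambient \<open>sup\<close> and \<open>inf\<close>,
  so these remain the bounds of pairs inside it. This and the next three facts supply the witnesses
  for the bounded lattice structure.\<close>

lemma least_Upper_interval:
  fixes m :: "'a::{distrib_lattice,bounded_lattice}"
  assumes "x \<in> {m..top}" "y \<in> {m..top}"
  shows "least (induced_order {m..top}) (sup x y) (Upper (induced_order {m..top}) {x, y})"
  using assms by (auto simp: least_def Upper_def intro: le_supI1)

lemma greatest_Lower_interval:
  fixes m :: "'a::{distrib_lattice,bounded_lattice}"
  assumes "x \<in> {m..top}" "y \<in> {m..top}"
  shows "greatest (induced_order {m..top}) (inf x y) (Lower (induced_order {m..top}) {x, y})"
  using assms by (auto simp: greatest_def Lower_def)

lemma least_interval:
  fixes m :: "'a::{distrib_lattice,bounded_lattice}"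
  shows "least (induced_order {m..top}) m {m..top}"
  by (auto simp: least_def)

lemma greatest_interval:
  fixes m :: "'a::{distrib_lattice,bounded_lattice}"
  shows "greatest (induced_order {m..top}) top {m..top}"
  by (auto simp: greatest_def)

text \<open>The operations of an ordered set are Hilbert choices of a least or greatest element;
  antisymmetry makes that element unique, so the choice is the ambient one.\<close>

lemma join_interval:
  fixes m :: "'a::{distrib_lattice,bounded_lattice}"
  assumes "x \<in> {m..top}" "y \<in> {m..top}"
  shows "x \<squnion>\<^bsub>induced_order {m..top}\<^esub> y = sup x y"
  unfolding join_def Lattice.sup_def
  using least_Upper_interval[OF assms]
    partial_order.least_unique[OF partial_order_induced_order]
  by (blast intro: some_equality)

lemma meet_interval:
  fixes m :: "'a::{distrib_lattice,bounded_lattice}"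
  assumes "x \<in> {m..top}" "y \<in> {m..top}"
  shows "x \<sqinter>\<^bsub>induced_order {m..top}\<^esub> y = inf x y"
  unfolding meet_def Lattice.inf_def
  using greatest_Lower_interval[OF assms]
    partial_order.greatest_unique[OF partial_order_induced_order]
  by (blast intro: some_equality)

lemma top_interval:
  fixes m :: "'a::{distrib_lattice,bounded_lattice}"
  shows "\<top>\<^bsub>induced_order {m..top}\<^esub> = top"
  unfolding Order.top_def carrier_induced_order
  using greatest_interval partial_order.greatest_unique[OF partial_order_induced_order]
  by (blast intro: some_equality)

lemma bottom_interval:
  fixes m :: "'a::{distrib_lattice,bounded_lattice}"
  shows "\<bottom>\<^bsub>induced_order {m..top}\<^esub> = m"
  unfolding bottom_def carrier_induced_order
  using least_interval partial_order.least_unique[OF partial_order_induced_order]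
  by (blast intro: some_equality)

text \<open>Turns complements in the ordered set into ambient lattice equations, the form in which
  they are computed below.\<close>

lemma is_complement_interval:
  fixes m :: "'a::{distrib_lattice,bounded_lattice}"
  shows "is_complement (induced_order {m..top}) x y \<longleftrightarrow>
    m \<le> x \<and> m \<le> y \<and> inf x y = m \<and> sup x y = top"
  by (auto simp: is_complement_def meet_interval join_interval top_interval bottom_interval)

lemma bounded_lattice_interval:
  fixes m :: "'a::{distrib_lattice,bounded_lattice}"
  shows "Lattice.bounded_lattice (induced_order {m..top})"
proof -
  interpret partial_order "induced_order {m..top}"
    by (rule partial_order_induced_order)
  show ?thesis
    by unfold_locales
      (use least_Upper_interval greatest_Lower_interval least_interval greatest_interval
        in \<open>fastforce+\<close>)
qed

text \<open>Distributivity is inherited from the ambient lattice, so only complements have to be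
  provided.\<close>

lemma boolean_lattice_intervalI:
  fixes m :: "'a::{distrib_lattice,bounded_lattice}"
  assumes "\<And>x. m \<le> x \<Longrightarrow> \<exists>y. is_complement (induced_order {m..top}) x y"
  shows "boolean_lattice (induced_order {m..top})"
proof -
  interpret Lattice.bounded_lattice "induced_order {m..top}"
    by (rule bounded_lattice_interval)
  show ?thesis
  proof
    fix x y z
    assume "x \<in> carrier (induced_order {m..top})" "y \<in> carrier (induced_order {m..top})"
      "z \<in> carrier (induced_order {m..top})"
    then have *: "x \<in> {m..top}" "y \<in> {m..top}" "z \<in> {m..top}"
      by simp_all
    \<comment> \<open>Side conditions for rewriting the outer operations of the nested
      terms.\<close>
    then have "sup y z \<in> {m..top}" "inf x y \<in> {m..top}" "inf x z \<in> {m..top}"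
      by (auto intro: le_supI1)
    with * show "x \<sqinter>\<^bsub>induced_order {m..top}\<^esub> (y \<squnion>\<^bsub>induced_order {m..top}\<^esub> z) =
      x \<sqinter>\<^bsub>induced_order {m..top}\<^esub> y \<squnion>\<^bsub>induced_order {m..top}\<^esub> (x \<sqinter>\<^bsub>induced_order {m..top}\<^esub> z)"
      by (simp only: meet_interval join_interval inf_sup_distrib1)
  qed (use assms in simp)
qed

text \<open>Relative complements in a distributive lattice are unique; this justifies the definite
  description in \<open>the_complement\<close>.\<close>

lemma is_complement_interval_unique:
  fixes m :: "'a::{distrib_lattice,bounded_lattice}"
  assumes "is_complement (induced_order {m..top}) x y"
    and "is_complement (induced_order {m..top}) x z"
  shows "y = z"
proof -
  have eqs: "inf x y = inf x z" "sup x y = sup x z"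
    using assms by (simp_all add: is_complement_interval)
  have "y = inf y (sup x y)"
    by (simp add: inf_absorb1)
  also have "\<dots> = sup (inf x y) (inf y z)"
    by (simp add: eqs(2) inf_sup_distrib1 inf_commute)
  also have "\<dots> = sup (inf x z) (inf y z)"
    by (simp add: eqs(1))
  also have "\<dots> = inf (sup x y) z"
    by (simp add: inf_sup_distrib2)
  also have "\<dots> = z"
    by (simp add: eqs(2) inf_absorb2)
  finally show ?thesis .
qed

section \<open>Weakly Boolean implications\<close>

lemma implication_antimono: "implication imp \<Longrightarrow> a \<le> b \<Longrightarrow> imp b c \<le> imp a c"
  and implication_mono: "implication imp \<Longrightarrow> a \<le> b \<Longrightarrow> imp c a \<le> imp c b"
  and implication_trans: "implication imp \<Longrightarrow> inf (imp a b) (imp b c) \<le> imp a c"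
  unfolding implication_def antimono_def mono_def by blast+

text \<open>Excluded middle is closedness at \<open>a \<le> sup bot a\<close>.\<close>

lemma closed_implication_sup_neg:
  assumes "closed_implication imp"
  shows "sup (neg imp a) a = top"
  using assms unfolding closed_implication_def neg_def by simp

text \<open>A weak law of contradiction, with \<open>neg imp top\<close> in place of
  \<open>bot\<close>: chain \<open>imp top a\<close> with \<open>imp a bot\<close>.\<close>

lemma open_implication_inf_neg_le:
  assumes "open_implication imp"
  shows "inf a (neg imp a) \<le> neg imp top"
proof -
  have imp: "implication imp" and "a \<le> imp top a"
    using assms by (simp_all add: open_implication_def)
  then have "inf a (imp a bot) \<le> inf (imp top a) (imp a bot)"
    by (intro inf_mono order_refl)
  also have "\<dots> \<le> imp top bot"
    by (rule implication_trans[OF imp])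
  finally show ?thesis
    by (simp add: neg_def)
qed

lemma weakly_boolean_implication_eq:
  assumes "weakly_boolean_implication imp"
  shows "imp a b = sup (neg imp a) b"
proof (rule antisym)
  have opn: "open_implication imp" and closed: "closed_implication imp"
    and imp: "implication imp"
    using assms by (auto simp: weakly_boolean_implication_def open_implication_def)
  \<comment> \<open>Excluded middle for \<open>b\<close> splits \<open>imp a b\<close>: the part
    below \<open>neg imp b\<close> composes to \<open>neg imp a\<close>, the rest lies below
    \<open>b\<close>.\<close>
  have "imp a b = inf (imp a b) (sup (neg imp b) b)"
    by (simp add: closed_implication_sup_neg[OF closed])
  also have "\<dots> = sup (inf (imp a b) (imp b bot)) (inf (imp a b) b)"
    by (simp add: inf_sup_distrib1 neg_def)
  also have "\<dots> \<le> sup (neg imp a) b"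
    unfolding neg_def by (intro sup_mono implication_trans[OF imp] inf_le2)
  finally show "imp a b \<le> sup (neg imp a) b" .
  \<comment> \<open>Openness at \<open>inf b a \<le> b\<close>; the other bound is monotonicity from
    \<open>bot \<le> b\<close>.\<close>
  have "b \<le> imp a b"
    using opn by (simp add: open_implication_def)
  then show "sup (neg imp a) b \<le> imp a b"
    by (simp add: neg_def implication_mono[OF imp])
qed

lemma weakly_boolean_implication_is_complement:
  assumes "weakly_boolean_implication imp"
  shows "is_complement (induced_order {neg imp top..top}) (sup a (neg imp top)) (neg imp a)"
proof -
  have opn: "open_implication imp" and closed: "closed_implication imp"
    and imp: "implication imp"
    using assms by (auto simp: weakly_boolean_implication_def open_implication_def)
  have le: "neg imp top \<le> neg imp a"
    unfolding neg_def by (rule implication_antimono[OF imp top_greatest])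
  \<comment> \<open>Since \<open>neg imp top\<close> is below \<open>neg imp a\<close>, it survives
    the meet unchanged after distributing.\<close>
  have "inf (sup a (neg imp top)) (neg imp a) = sup (inf a (neg imp a)) (neg imp top)"
    by (simp add: inf_sup_distrib2 inf_absorb1[OF le])
  also have "\<dots> = neg imp top"
    by (rule sup_absorb2[OF open_implication_inf_neg_le[OF opn]])
  finally have "inf (sup a (neg imp top)) (neg imp a) = neg imp top" .
  moreover have "sup (sup a (neg imp top)) (neg imp a) = top"
    using closed_implication_sup_neg[OF closed, of a]
    by (simp add: sup_assoc sup_absorb2[OF le] sup_commute[of _ a])
  ultimately show ?thesis
    using le by (simp add: is_complement_interval)
qed

lemma weakly_boolean_implication_boolean_lattice:
  assumes "weakly_boolean_implication imp"
  shows "boolean_lattice (induced_order {neg imp top..top})"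
proof (rule boolean_lattice_intervalI)
  fix x
  assume "neg imp top \<le> x"
  \<comment> \<open>An \<open>x\<close> in the interval absorbs \<open>neg imp top\<close>, so
    \<open>sup x (neg imp top)\<close> is \<open>x\<close> itself.\<close>
  then have "is_complement (induced_order {neg imp top..top}) x (neg imp x)"
    using weakly_boolean_implication_is_complement[OF assms, of x] by (simp add: sup_absorb1)
  then show "\<exists>y. is_complement (induced_order {neg imp top..top}) x y" ..
qed

section \<open>The implication of a Boolean upper interval\<close>

text \<open>Existence comes from the Boolean hypothesis and uniqueness from distributivity, so the
  description behind \<open>interval_neg\<close> denotes.\<close>

lemma interval_neg_is_complement:
  fixes m :: "'a::{distrib_lattice,bounded_lattice}"
  assumes "boolean_lattice (induced_order {m..top})"
  shows "is_complement (induced_order {m..top}) (sup a m) (interval_neg m a)"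
proof -
  have "\<exists>y. is_complement (induced_order {m..top}) (sup a m) y"
    using boolean_lattice.complement_exists[OF assms] by simp
  then have "\<exists>!y. is_complement (induced_order {m..top}) (sup a m) y"
    using is_complement_interval_unique by blast
  then show ?thesis
    unfolding interval_neg_def the_complement_def by (rule theI')
qed

context
  fixes m :: "'a::{distrib_lattice,bounded_lattice}"
  assumes boolean: "boolean_lattice (induced_order {m..top})"
begin

text \<open>The other laws in this context are derived from these three. In the last one
  \<open>m\<close> drops out of the join because \<open>interval_neg m a\<close> absorbs it.\<close>

lemma le_interval_neg: "m \<le> interval_neg m a"
  and inf_interval_neg_eq: "inf (sup a m) (interval_neg m a) = m"
  and sup_interval_neg: "sup a (interval_neg m a) = top"
proof -
  show le: "m \<le> interval_neg m a" and "inf (sup a m) (interval_neg m a) = m"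
    using interval_neg_is_complement[OF boolean, of a] by (simp_all add: is_complement_interval)
  show "sup a (interval_neg m a) = top"
    using interval_neg_is_complement[OF boolean, of a]
    by (simp add: is_complement_interval sup_assoc sup_absorb2[OF le])
qed

lemma inf_interval_neg_le: "inf a (interval_neg m a) \<le> m"
  using inf_mono[OF sup_ge1[of a m] order_refl[of "interval_neg m a"]]
  by (simp add: inf_interval_neg_eq)

lemma interval_neg_top: "interval_neg m top = m"
  using inf_interval_neg_eq[of top] by simp

text \<open>Split \<open>interval_neg m b\<close> along
  \<open>sup a (interval_neg m a) = top\<close>: the part below \<open>a\<close> is below
  \<open>b\<close>, hence below \<open>m\<close> and so below
  \<open>interval_neg m a\<close>.\<close>

lemma interval_neg_antimono:
  assumes "a \<le> b"
  shows "interval_neg m b \<le> interval_neg m a"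
proof -
  have "interval_neg m b = inf (interval_neg m b) (sup a (interval_neg m a))"
    by (simp add: sup_interval_neg)
  also have "\<dots> \<le> sup (inf b (interval_neg m b)) (interval_neg m a)"
    unfolding inf_sup_distrib1 using assms
    by (intro sup_mono inf_le2) (simp add: le_infI2)
  also have "\<dots> \<le> interval_neg m a"
    using inf_interval_neg_le le_interval_neg by (blast intro: le_supI order_trans)
  finally show ?thesis .
qed

lemma interval_imp_trans:
  "inf (interval_imp m a b) (interval_imp m b c) \<le> interval_imp m a c"
proof -
  \<comment> \<open>The middle term \<open>b\<close> cancels: against its negation it falls to
    \<open>m\<close>, which \<open>interval_neg m a\<close> absorbs, and against \<open>c\<close> it
    leaves at most \<open>c\<close>.\<close>
  have "inf b (interval_neg m b) \<le> interval_neg m a"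
    using inf_interval_neg_le le_interval_neg by (rule order_trans)
  then have "sup (interval_neg m a) (inf b (sup (interval_neg m b) c)) \<le> interval_imp m a c"
    unfolding interval_imp_def inf_sup_distrib1 by (auto intro: le_supI1 le_supI2 le_infI2)
  moreover have "inf (interval_imp m a b) (interval_imp m b c)
      \<le> sup (interval_neg m a) (inf b (sup (interval_neg m b) c))"
    unfolding interval_imp_def
    by (subst inf_sup_distrib2) (intro sup_mono inf_le1 order_refl)
  ultimately show ?thesis
    by (rule order_trans[rotated])
qed

lemma implication_interval_imp: "implication (interval_imp m)"
  unfolding implication_def
proof (intro conjI allI)
  show "antimono (\<lambda>a. interval_imp m a c)" for c
    unfolding interval_imp_def by (intro antimonoI sup_mono interval_neg_antimono order_refl)
  show "mono (interval_imp m c)" for c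
    unfolding interval_imp_def by (intro monoI sup_mono order_refl)
  show "interval_imp m a a = top" for a
    by (simp add: interval_imp_def sup_commute[of _ a] sup_interval_neg)
qed (rule interval_imp_trans)

lemma open_implication_interval_imp: "open_implication (interval_imp m)"
  unfolding open_implication_def
proof (intro conjI allI impI implication_interval_imp)
  fix a b c :: 'a
  assume "inf a b \<le> c"
  \<comment> \<open>Excluded middle for \<open>b\<close> splits \<open>a\<close> into a part below
    \<open>c\<close> and a part below \<open>interval_neg m b\<close>.\<close>
  have "a = inf a (sup b (interval_neg m b))"
    by (simp add: sup_interval_neg)
  also have "\<dots> \<le> sup c (interval_neg m b)"
    unfolding inf_sup_distrib1 by (intro sup_mono \<open>inf a b \<le> c\<close> inf_le2)
  finally show "a \<le> interval_imp m b c"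
    by (simp add: interval_imp_def sup_commute)
qed

lemma closed_implication_interval_imp: "closed_implication (interval_imp m)"
  unfolding closed_implication_def
proof (intro conjI allI impI implication_interval_imp)
  fix a b c :: 'a
  assume "a \<le> sup b c"
  \<comment> \<open>Joining with \<open>interval_neg m a\<close> turns the left side into
    \<open>top\<close> by excluded middle.\<close>
  then have "sup (interval_neg m a) a \<le> sup (interval_neg m a) (sup b c)"
    by (intro sup_mono order_refl)
  then show "sup (interval_imp m a b) c = top"
    by (simp add: interval_imp_def sup_commute[of _ a] sup_interval_neg sup_assoc top_unique)
qed

lemma weakly_boolean_implication_interval_imp: "weakly_boolean_implication (interval_imp m)"
  by (simp add: weakly_boolean_implication_def open_implication_interval_imp
      closed_implication_interval_imp)

end

lemma neg_interval_imp: "neg (interval_imp m) a = interval_neg m a"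
  by (simp add: neg_def interval_imp_def)

theorem theorem3p12:
  shows "(\<forall>imp :: 'a::{distrib_lattice,bounded_lattice} \<Rightarrow> 'a \<Rightarrow> 'a.
            weakly_boolean_implication imp \<longrightarrow>
              boolean_lattice (induced_order {neg imp top..top}) \<and>
              (\<forall>a b. imp a b = sup (neg imp a) b) \<and>
              (\<forall>a. is_complement (induced_order {neg imp top..top})
                     (sup a (neg imp top)) (neg imp a))) \<and>
         (\<forall>m :: 'a.
            boolean_lattice (induced_order {m..top}) \<longrightarrow>
              weakly_boolean_implication (interval_imp m) \<and>
              (\<forall>a. neg (interval_imp m) a = interval_neg m a) \<and>
              neg (interval_imp m) top = interval_neg m top \<and>
              interval_neg m top = m)"
  using weakly_boolean_implication_boolean_lattice weakly_boolean_implication_eq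
    weakly_boolean_implication_is_complement weakly_boolean_implication_interval_imp
    neg_interval_imp interval_neg_top
  by metis

end
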